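(* Consider the coupling method described in the context. If all the subdomains employ the Newmark average acceleration scheme (i.e., $\gamma_i=1/2$ and $\beta_i=1/4$ for all $i=1,\dots,S$), and there is no subcycling (i.e., $\eta_i=1$ for all $i$), then the coupling method exactly conserves energy when $\boldsymbol{f}_i(t)=\boldsymbol{0}$ for all $i$; that is, $\mathcal{E}^{(n+1)}=\mathcal{E}^{(n)}$ for all $n=0,1,2,\dots$.
   Context: Data. Let $S\ge 1$ (number of subdomains), $N_C\ge 1$ and $N_i\ge 1$ be integers. For $i=1,\dots,S$ let $\boldsymbol{M}_i\in\mathbb{R}^{N_i\times N_i}$ be symmetric positive definite (mass matrix), $\boldsymbol{K}_i\in\mathbb{R}^{N_i\times N_i}$ symmetric positive semidefinite (stiffness matrix), $\boldsymbol{f}_i(t)\in\mathbb{R}^{N_i}$ the external force, and $\boldsymbol{C}_i\in\mathbb{R}^{N_C\times N_i}$ a signed Boolean matrix (entries in $\{0,1,-1\}$, at most one non-zero entry per row). Let $\beta_i,\gamma_i\in\mathbb{R}$ be the Newmark parameters of subdomain $i$. Let $\Delta t>0$ be the system time-step, $\eta_i\ge 1$ integers, and $\Delta t_i=\Delta t/\eta_i$ the subdomain time-steps. A superscript $(n+j/\eta_i)$ denotes the value at time $n\Delta t+j\Delta t_i$. Coupling method. The method produces vectors $\boldsymbol{d}_i^{(n+j/\eta_i)},\boldsymbol{v}_i^{(n+j/\eta_i)},\boldsymbol{a}_i^{(n+j/\eta_i)}\in\mathbb{R}^{N_i}$ (displacement, velocity, acceleration) and $\boldsymbol{\lambda}^{(n)}\in\mathbb{R}^{N_C}$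 (Lagrange multipliers at system time levels) satisfying, for all $n=0,1,2,\dots$, all $i=1,\dots,S$ and all $j=0,\dots,\eta_i-1$: (1) $\boldsymbol{M}_i\boldsymbol{a}_i^{(n+(j+1)/\eta_i)}+\boldsymbol{K}_i\boldsymbol{d}_i^{(n+(j+1)/\eta_i)}=\boldsymbol{f}_i^{(n+(j+1)/\eta_i)}+\boldsymbol{C}_i^{\mathrm T}\boldsymbol{\lambda}^{(n+(j+1)/\eta_i)}$, where multipliers are linearly interpolated within a system time-step: $\boldsymbol{\lambda}^{(n+j/\eta_i)}=(1-\tfrac{j}{\eta_i})\boldsymbol{\lambda}^{(n)}+\tfrac{j}{\eta_i}\boldsymbol{\lambda}^{(n+1)}$; (2) $\boldsymbol{d}_i^{(n+(j+1)/\eta_i)}=\boldsymbol{d}_i^{(n+j/\eta_i)}+\Delta t_i\boldsymbol{v}_i^{(n+j/\eta_i)}+\tfrac{\Delta t_i^2}{2}\big((1-2\beta_i)\boldsymbol{a}_i^{(n+j/\eta_i)}+2\beta_i\boldsymbol{a}_i^{(n+(j+1)/\eta_i)}\big)$; (3) $\boldsymbol{v}_i^{(n+(j+1)/\eta_i)}=\boldsymbol{v}_i^{(n+j/\eta_i)}+\Delta t_i\big((1-\gamma_i)\boldsymbol{a}_i^{(n+j/\eta_i)}+\gamma_i\boldsymbol{a}_i^{(n+(j+1)/\eta_i)}\big)$; (4) continuity of velocities at system time levels: $\sum_{i=1}^{S}\boldsymbol{C}_i\boldsymbol{v}_i^{(n+1)}=\boldsymbol{0}$. The initial values are consistent: $\boldsymbol{M}_i\boldsymbol{a}_i^{(0)}+\boldsymbol{K}_i\boldsymbol{d}_i^{(0)}=\boldsymbol{f}_i^{(0)}+\boldsymbol{C}_i^{\mathrm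 T}\boldsymbol{\lambda}^{(0)}$ for all $i$ and $\sum_{i=1}^{S}\boldsymbol{C}_i\boldsymbol{v}_i^{(0)}=\boldsymbol{0}$. Energy. The total energy of all the subdomains at the $n$-th system time level is $$\mathcal{E}^{(n)}:=\sum_{i=1}^{S}\Big(\tfrac12\,{\boldsymbol{v}_i^{(n)}}^{\mathrm T}\boldsymbol{M}_i\boldsymbol{v}_i^{(n)}+\tfrac12\,{\boldsymbol{d}_i^{(n)}}^{\mathrm T}\boldsymbol{K}_i\boldsymbol{d}_i^{(n)}\Big).$$ *)

theory Defs
  imports Complex_Main "Jordan_Normal_Form.Matrix"
begin

definition sym_pos_def_mat :: "nat \<Rightarrow> real mat \<Rightarrow> bool" where
  "sym_pos_def_mat n A \<longleftrightarrow> A \<in> carrier_mat n n \<and> transpose_mat A = A \<and>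
     (\<forall>x \<in> carrier_vec n. x \<noteq> 0\<^sub>v n \<longrightarrow> x \<bullet> (A *\<^sub>v x) > 0)"

definition sym_pos_semidef_mat :: "nat \<Rightarrow> real mat \<Rightarrow> bool" where
  "sym_pos_semidef_mat n A \<longleftrightarrow> A \<in> carrier_mat n n \<and> transpose_mat A = A \<and>
     (\<forall>x \<in> carrier_vec n. x \<bullet> (A *\<^sub>v x) \<ge> 0)"

definition signed_boolean_mat :: "nat \<Rightarrow> nat \<Rightarrow> real mat \<Rightarrow> bool" where
  "signed_boolean_mat m n A \<longleftrightarrow> A \<in> carrier_mat m n \<and>
     (\<forall>r < m. \<forall>c < n. A $$ (r, c) \<in> {0, 1, -1}) \<and>
     (\<forall>r < m. card {c. c < n \<and> A $$ (r, c) \<noteq> 0} \<le> 1)"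

locale coupling_data =
  fixes S NC :: nat
    and N :: "nat \<Rightarrow> nat"
    and M K C :: "nat \<Rightarrow> real mat"
    and f :: "nat \<Rightarrow> real \<Rightarrow> real vec"
    and \<beta> \<gamma> :: "nat \<Rightarrow> real"
    and \<Delta>t :: real
    and \<eta> :: "nat \<Rightarrow> nat"
  assumes S_ge_1: "S \<ge> 1"
    and NC_ge_1: "NC \<ge> 1"
    and N_ge_1: "\<And>i. i \<in> {1..S} \<Longrightarrow> N i \<ge> 1"
    and mass: "\<And>i. i \<in> {1..S} \<Longrightarrow> sym_pos_def_mat (N i) (M i)"
    and stiffness: "\<And>i. i \<in> {1..S} \<Longrightarrow> sym_pos_semidef_mat (N i) (K i)"
    and signed_boolean: "\<And>i. i \<in> {1..S} \<Longrightarrow> signed_boolean_mat NC (N i) (C i)"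
    and force_carrier: "\<And>i t. i \<in> {1..S} \<Longrightarrow> t \<ge> 0 \<Longrightarrow> f i t \<in> carrier_vec (N i)"
    and time_step_pos: "\<Delta>t > 0"
    and \<eta>_ge_1: "\<And>i. i \<in> {1..S} \<Longrightarrow> \<eta> i \<ge> 1"

definition subdomain_time_step :: "real \<Rightarrow> (nat \<Rightarrow> nat) \<Rightarrow> nat \<Rightarrow> real" where
  "subdomain_time_step \<Delta>t \<eta> i = \<Delta>t / real (\<eta> i)"

text \<open>The multiplier at the fractional level \<open>n + j / e\<close>, from its values at the system
  time levels.\<close>

definition interp_multiplier :: "(nat \<Rightarrow> real vec) \<Rightarrow> nat \<Rightarrow> nat \<Rightarrow> nat \<Rightarrow> real vec" where
  "interp_multiplier lam e n j =
     (1 - real j / real e) \<cdot>\<^sub>v lam n + (real j / real e) \<cdot>\<^sub>v lam (n + 1)"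

text \<open>The kinematic quantities of subdomain \<open>i\<close> are sequences over its own time grid:
  \<open>d i k\<close> is the displacement at time \<open>k * \<Delta>t / \<eta> i\<close>. Hence the value at level
  \<open>n + j / \<eta> i\<close> is \<open>d i (n * \<eta> i + j)\<close>, and the one at the system time level \<open>n\<close> is
  \<open>d i (n * \<eta> i)\<close>. The multiplier \<open>lam n\<close> is indexed by system time levels.\<close>

locale coupling_method = coupling_data S NC N M K C f \<beta> \<gamma> \<Delta>t \<eta>
  for S NC :: nat
    and N :: "nat \<Rightarrow> nat"
    and M K C :: "nat \<Rightarrow> real mat"
    and f :: "nat \<Rightarrow> real \<Rightarrow> real vec"
    and \<beta> \<gamma> :: "nat \<Rightarrow> real"
    and \<Delta>t :: real
    and \<eta> :: "nat \<Rightarrow> nat" +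
  fixes d v a :: "nat \<Rightarrow> nat \<Rightarrow> real vec"
    and lam :: "nat \<Rightarrow> real vec"
  assumes d_carrier: "\<And>i k. i \<in> {1..S} \<Longrightarrow> d i k \<in> carrier_vec (N i)"
    and v_carrier: "\<And>i k. i \<in> {1..S} \<Longrightarrow> v i k \<in> carrier_vec (N i)"
    and a_carrier: "\<And>i k. i \<in> {1..S} \<Longrightarrow> a i k \<in> carrier_vec (N i)"
    and lam_carrier: "\<And>n. lam n \<in> carrier_vec NC"
    and equilibrium: "\<And>n i j. i \<in> {1..S} \<Longrightarrow> j < \<eta> i \<Longrightarrow>
      M i *\<^sub>v a i (n * \<eta> i + (j + 1)) + K i *\<^sub>v d i (n * \<eta> i + (j + 1)) =
      f i (real n * \<Delta>t + real (j + 1) * subdomain_time_step \<Delta>t \<eta> i)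
        + transpose_mat (C i) *\<^sub>v interp_multiplier lam (\<eta> i) n (j + 1)"
    and newmark_displacement: "\<And>n i j. i \<in> {1..S} \<Longrightarrow> j < \<eta> i \<Longrightarrow>
      d i (n * \<eta> i + (j + 1)) =
      d i (n * \<eta> i + j) + subdomain_time_step \<Delta>t \<eta> i \<cdot>\<^sub>v v i (n * \<eta> i + j)
        + ((subdomain_time_step \<Delta>t \<eta> i)\<^sup>2 / 2) \<cdot>\<^sub>v
            ((1 - 2 * \<beta> i) \<cdot>\<^sub>v a i (n * \<eta> i + j)
              + (2 * \<beta> i) \<cdot>\<^sub>v a i (n * \<eta> i + (j + 1)))"
    and newmark_velocity: "\<And>n i j. i \<in> {1..S} \<Longrightarrow> j < \<eta> i \<Longrightarrow>
      v i (n * \<eta> i + (j + 1)) =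
      v i (n * \<eta> i + j) + subdomain_time_step \<Delta>t \<eta> i \<cdot>\<^sub>v
        ((1 - \<gamma> i) \<cdot>\<^sub>v a i (n * \<eta> i + j) + \<gamma> i \<cdot>\<^sub>v a i (n * \<eta> i + (j + 1)))"
    and velocity_continuity: "\<And>n.
      finsum_vec TYPE(real) NC (\<lambda>i. C i *\<^sub>v v i ((n + 1) * \<eta> i)) {1..S} = 0\<^sub>v NC"
    and initial_equilibrium: "\<And>i. i \<in> {1..S} \<Longrightarrow>
      M i *\<^sub>v a i 0 + K i *\<^sub>v d i 0 = f i 0 + transpose_mat (C i) *\<^sub>v lam 0"
    and initial_continuity:
      "finsum_vec TYPE(real) NC (\<lambda>i. C i *\<^sub>v v i 0) {1..S} = 0\<^sub>v NC"

definition total_energy ::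
  "nat \<Rightarrow> (nat \<Rightarrow> real mat) \<Rightarrow> (nat \<Rightarrow> real mat) \<Rightarrow> (nat \<Rightarrow> nat) \<Rightarrow>
   (nat \<Rightarrow> nat \<Rightarrow> real vec) \<Rightarrow> (nat \<Rightarrow> nat \<Rightarrow> real vec) \<Rightarrow> nat \<Rightarrow> real" where
  "total_energy S M K \<eta> d v n =
     (\<Sum>i = 1..S. 1 / 2 * (v i (n * \<eta> i) \<bullet> (M i *\<^sub>v v i (n * \<eta> i)))
                + 1 / 2 * (d i (n * \<eta> i) \<bullet> (K i *\<^sub>v d i (n * \<eta> i))))"

end

theory Submission
  imports Defs
begin

text \<open>
  For the average acceleration scheme the two Newmark updates are trapezoidal rules: the increment
  of \<open>v\<close> over a step of length \<open>h\<close> is \<open>h/2\<close> times the sum of the two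
  end point accelerations, and the increment of \<open>d\<close> is \<open>h/2\<close> times the
  sum of the two end point velocities. A symmetric quadratic form changes by
  \<open>(x + y) \<bullet> A (x - y)\<close>, so the change of the kinetic plus potential energy of one
  subdomain pairs the single vector \<open>v\<^sub>0 + v\<^sub>1\<close> with the sum of the inertial and
  elastic forces at both ends of the step. By equilibrium this is the work of the interface forces,
  \<open>h/4 (v\<^sub>0 + v\<^sub>1) \<bullet> C\<^sup>T (\<lambda>\<^sub>0 + \<lambda>\<^sub>1)\<close>
  (\<open>trapezoidal_energy_balance\<close>).

  Moving \<open>C\<^sup>T\<close> to the other side and summing over the subdomains, this work becomes
  \<open>\<lambda>\<^sub>0 + \<lambda>\<^sub>1\<close> paired with the sum of the interface velocities
  \<open>C v\<close> at the two levels. Both of these sums vanish by velocity continuity, so the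
  interface does no net work. Without subcycling every subdomain level is a system level, which is
  why continuity is available at both ends of each step.
\<close>

lemma quadratic_form_diff:
  fixes A :: "real mat"
  assumes A: "A \<in> carrier_mat n n" and sym: "transpose_mat A = A"
    and x: "x \<in> carrier_vec n" and y: "y \<in> carrier_vec n"
  shows "x \<bullet> (A *\<^sub>v x) - y \<bullet> (A *\<^sub>v y) = (x + y) \<bullet> (A *\<^sub>v (x - y))"
proof -
  have Ax: "A *\<^sub>v x \<in> carrier_vec n" and Ay: "A *\<^sub>v y \<in> carrier_vec n"
    using A x y by auto
  have "x \<bullet> (A *\<^sub>v y) = (A *\<^sub>v x) \<bullet> y"
    using transpose_vec_mult_scalar[OF A y x] sym by simp
  also have "\<dots> = y \<bullet> (A *\<^sub>v x)"
    by (rule comm_scalar_prod[OF Ax y])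
  finally have swap: "x \<bullet> (A *\<^sub>v y) = y \<bullet> (A *\<^sub>v x)" .
  have "(x + y) \<bullet> (A *\<^sub>v (x - y)) = (x + y) \<bullet> (A *\<^sub>v x - A *\<^sub>v y)"
    by (simp add: mult_minus_distrib_mat_vec[OF A x y])
  also have "\<dots> = x \<bullet> (A *\<^sub>v x) - x \<bullet> (A *\<^sub>v y) + (y \<bullet> (A *\<^sub>v x) - y \<bullet> (A *\<^sub>v y))"
    using x y Ax Ay
    by (simp add: add_scalar_prod_distrib[of _ n] scalar_prod_minus_distrib[of _ n])
  finally show ?thesis
    using swap by simp
qed

text \<open>
  Both energies change by a pairing with the same vector \<open>v\<^sub>0 + v\<^sub>1\<close>: for the
  kinetic part it is the sum in the quadratic form, for the potential part it is the increment,
  moved across by symmetry of \<open>K\<close>. Hence the two changes combine into the work of the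
  total force.
\<close>

lemma trapezoidal_energy_balance:
  fixes M K :: "real mat"
  assumes M: "M \<in> carrier_mat n n" "transpose_mat M = M"
    and K: "K \<in> carrier_mat n n" "transpose_mat K = K"
    and carr: "v0 \<in> carrier_vec n" "d0 \<in> carrier_vec n" "a0 \<in> carrier_vec n" "a1 \<in> carrier_vec n"
    and v1: "v1 = v0 + (h / 2) \<cdot>\<^sub>v (a0 + a1)"
    and d1: "d1 = d0 + (h / 2) \<cdot>\<^sub>v (v0 + v1)"
    and g0: "M *\<^sub>v a0 + K *\<^sub>v d0 = g0"
    and g1: "M *\<^sub>v a1 + K *\<^sub>v d1 = g1"
  shows "(1 / 2 * (v1 \<bullet> (M *\<^sub>v v1)) + 1 / 2 * (d1 \<bullet> (K *\<^sub>v d1)))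
       - (1 / 2 * (v0 \<bullet> (M *\<^sub>v v0)) + 1 / 2 * (d0 \<bullet> (K *\<^sub>v d0)))
       = h / 4 * ((v0 + v1) \<bullet> (g0 + g1))"
proof -
  have v1c: "v1 \<in> carrier_vec n" and d1c: "d1 \<in> carrier_vec n"
    using carr v1 d1 by auto
  define w where "w = v0 + v1"
  have wc: "w \<in> carrier_vec n"
    using carr v1c w_def by simp
  have sa: "a0 + a1 \<in> carrier_vec n" and sd: "d1 + d0 \<in> carrier_vec n"
    using carr d1c by auto
  have Msa: "M *\<^sub>v (a0 + a1) \<in> carrier_vec n" and Ksd: "K *\<^sub>v (d1 + d0) \<in> carrier_vec n"
    using M(1) K(1) sa sd by auto
  have Kw: "K *\<^sub>v w \<in> carrier_vec n"
    using K(1) wc by simp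
  have dv: "v1 - v0 = (h / 2) \<cdot>\<^sub>v (a0 + a1)"
    using carr v1 by (intro eq_vecI) auto
  have dd: "d1 - d0 = (h / 2) \<cdot>\<^sub>v w"
    using carr v1c d1 unfolding w_def by (intro eq_vecI) auto
  have w_comm: "v1 + v0 = w"
    unfolding w_def by (rule comm_add_vec[OF v1c carr(1)])
  have kin: "v1 \<bullet> (M *\<^sub>v v1) - v0 \<bullet> (M *\<^sub>v v0) = h / 2 * (w \<bullet> (M *\<^sub>v (a0 + a1)))"
    using quadratic_form_diff[OF M v1c carr(1)] mult_mat_vec[OF M(1) sa]
      scalar_prod_smult_distrib[OF wc Msa]
    by (simp add: dv w_comm)
  have "(d1 + d0) \<bullet> (K *\<^sub>v w) = (K *\<^sub>v (d1 + d0)) \<bullet> w"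
    using transpose_vec_mult_scalar[OF K(1) wc sd] K(2) by simp
  also have "\<dots> = w \<bullet> (K *\<^sub>v (d1 + d0))"
    by (rule comm_scalar_prod[OF Ksd wc])
  finally have swap: "(d1 + d0) \<bullet> (K *\<^sub>v w) = w \<bullet> (K *\<^sub>v (d1 + d0))" .
  have pot: "d1 \<bullet> (K *\<^sub>v d1) - d0 \<bullet> (K *\<^sub>v d0) = h / 2 * (w \<bullet> (K *\<^sub>v (d1 + d0)))"
    using quadratic_form_diff[OF K d1c carr(2)] mult_mat_vec[OF K(1) wc]
      scalar_prod_smult_distrib[OF sd Kw]
    by (simp add: dd swap)
  have "M *\<^sub>v (a0 + a1) + K *\<^sub>v (d1 + d0) = g0 + g1"
    unfolding g0[symmetric] g1[symmetric]
      mult_add_distrib_mat_vec[OF M(1) carr(3,4)] mult_add_distrib_mat_vec[OF K(1) d1c carr(2)]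
    using M(1) K(1) by (intro eq_vecI) auto
  hence "w \<bullet> (g0 + g1) = w \<bullet> (M *\<^sub>v (a0 + a1)) + w \<bullet> (K *\<^sub>v (d1 + d0))"
    using scalar_prod_add_distrib[OF wc Msa Ksd] by simp
  moreover have "h / 4 * (p + q) = 1 / 2 * (h / 2 * p) + 1 / 2 * (h / 2 * q)" for p q :: real
    by (simp add: field_simps)
  ultimately show ?thesis
    using kin pot unfolding w_def[symmetric] by simp
qed

text \<open>
  Here \<open>\<beta> = 1/4\<close> enters: it makes the acceleration terms exactly those hidden in
  \<open>v\<^sub>1 = v + h/2 (a\<^sub>0 + a\<^sub>1)\<close>, so the displacement update is the trapezoidal
  rule for the velocities.
\<close>

lemma newmark_average_displacement:
  fixes d v a0 a1 :: "real vec"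
  assumes "d \<in> carrier_vec n" "v \<in> carrier_vec n" "a0 \<in> carrier_vec n" "a1 \<in> carrier_vec n"
  shows "d + h \<cdot>\<^sub>v v + (h\<^sup>2 / 2) \<cdot>\<^sub>v ((1 / 2) \<cdot>\<^sub>v a0 + (1 / 2) \<cdot>\<^sub>v a1)
       = d + (h / 2) \<cdot>\<^sub>v (v + (v + (h / 2) \<cdot>\<^sub>v (a0 + a1)))"
  using assms by (intro eq_vecI) (auto simp: field_simps power2_eq_square)

lemma scalar_prod_finsum_vec:
  fixes X :: "'b \<Rightarrow> 'a :: comm_semiring_0 vec"
  assumes "finite I" and u: "u \<in> carrier_vec n" and X: "\<And>i. i \<in> I \<Longrightarrow> X i \<in> carrier_vec n"
  shows "u \<bullet> finsum_vec TYPE('a) n X I = (\<Sum>i\<in>I. u \<bullet> X i)"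
proof -
  have X': "X \<in> I \<rightarrow> carrier_vec n"
    using X by auto
  have "u \<bullet> finsum_vec TYPE('a) n X I = (\<Sum>k = 0..<n. u $ k * finsum_vec TYPE('a) n X I $ k)"
    using finsum_vec_closed[OF X'] by (simp add: scalar_prod_def)
  also have "\<dots> = (\<Sum>k = 0..<n. \<Sum>i\<in>I. u $ k * X i $ k)"
    by (simp add: index_finsum_vec[OF assms(1) _ X'] sum_distrib_left)
  also have "\<dots> = (\<Sum>i\<in>I. \<Sum>k = 0..<n. u $ k * X i $ k)"
    by (rule sum.swap)
  also have "\<dots> = (\<Sum>i\<in>I. u \<bullet> X i)"
    by (intro sum.cong) (simp_all add: scalar_prod_def carrier_vecD[OF X])
  finally show ?thesis .
qed

context coupling_method
begin

lemma continuity_at_level: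
  "finsum_vec TYPE(real) NC (\<lambda>i. C i *\<^sub>v v i (n * \<eta> i)) {1..S} = 0\<^sub>v NC"
  using velocity_continuity initial_continuity by (cases n) simp_all

lemma C_carrier: "i \<in> {1..S} \<Longrightarrow> C i \<in> carrier_mat NC (N i)"
  using signed_boolean by (simp add: signed_boolean_mat_def)

lemma interface_force_carrier:
  assumes "i \<in> {1..S}" and "\<mu> \<in> carrier_vec NC"
  shows "transpose_mat (C i) *\<^sub>v \<mu> \<in> carrier_vec (N i)"
  using C_carrier[OF assms(1)] assms(2)
  by (intro mult_mat_vec_carrier[of _ _ NC]) simp_all

text \<open>
  Moving each \<open>C\<^sub>i\<^sup>T\<close> onto the velocities leaves \<open>\<mu>\<close> paired with the
  velocity jump at the interface, which is zero.
\<close>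

lemma interface_power_zero:
  assumes mu: "\<mu> \<in> carrier_vec NC"
  shows "(\<Sum>i = 1..S. v i (n * \<eta> i) \<bullet> (transpose_mat (C i) *\<^sub>v \<mu>)) = 0"
proof -
  have "v i (n * \<eta> i) \<bullet> (transpose_mat (C i) *\<^sub>v \<mu>) = \<mu> \<bullet> (C i *\<^sub>v v i (n * \<eta> i))"
    if i: "i \<in> {1..S}" for i
  proof -
    have "v i (n * \<eta> i) \<bullet> (transpose_mat (C i) *\<^sub>v \<mu>) = (transpose_mat (C i) *\<^sub>v \<mu>) \<bullet> v i (n * \<eta> i)"
      by (rule comm_scalar_prod[OF v_carrier[OF i] interface_force_carrier[OF i mu]])
    thus ?thesis
      using transpose_vec_mult_scalar[OF C_carrier[OF i] v_carrier[OF i] mu] by simp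
  qed
  hence "(\<Sum>i = 1..S. v i (n * \<eta> i) \<bullet> (transpose_mat (C i) *\<^sub>v \<mu>))
      = (\<Sum>i = 1..S. \<mu> \<bullet> (C i *\<^sub>v v i (n * \<eta> i)))"
    by (rule sum.cong[OF refl])
  also have "\<dots> = \<mu> \<bullet> finsum_vec TYPE(real) NC (\<lambda>i. C i *\<^sub>v v i (n * \<eta> i)) {1..S}"
    by (rule scalar_prod_finsum_vec[symmetric]) (use mu mult_mat_vec_carrier[OF C_carrier v_carrier] in simp_all)
  finally show ?thesis
    unfolding continuity_at_level using mu by simp
qed

text \<open>
  The stepping equations impose equilibrium only at the end of each step, so level \<open>0\<close>
  comes from the consistency of the initial values. The energy balance needs equilibrium at both
  ends of every step, including the start of the first one.
\<close>

lemma equilibrium_at_level: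
  assumes i: "i \<in> {1..S}" and eta: "\<eta> i = 1"
    and f0: "\<And>t. t \<ge> 0 \<Longrightarrow> f i t = 0\<^sub>v (N i)"
  shows "M i *\<^sub>v a i n + K i *\<^sub>v d i n = transpose_mat (C i) *\<^sub>v lam n"
proof -
  have carr: "transpose_mat (C i) *\<^sub>v lam n \<in> carrier_vec (N i)" for n
    by (rule interface_force_carrier[OF i lam_carrier])
  show ?thesis
  proof (cases n)
    case 0
    thus ?thesis
      using initial_equilibrium[OF i] f0[of 0] carr[of 0] by simp
  next
    case (Suc m)
    \<comment> \<open>With one substep per system step, interpolation at its end returns the new multiplier.\<close>
    have interp: "interp_multiplier lam 1 m 1 = lam (Suc m)"
      unfolding interp_multiplier_def
      using lam_carrier[of m] lam_carrier[of "Suc m"] by (intro eq_vecI) auto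
    have "f i (real m * \<Delta>t + real (0 + 1) * subdomain_time_step \<Delta>t \<eta> i) = 0\<^sub>v (N i)"
      using time_step_pos by (intro f0) (simp add: subdomain_time_step_def)
    thus ?thesis
      using equilibrium[OF i, of 0 m] carr[of "Suc m"] eta interp Suc by simp
  qed
qed

lemma subdomain_energy_change:
  assumes i: "i \<in> {1..S}" and eta: "\<eta> i = 1" and gam: "\<gamma> i = 1 / 2" and bet: "\<beta> i = 1 / 4"
    and f0: "\<And>t. t \<ge> 0 \<Longrightarrow> f i t = 0\<^sub>v (N i)"
  shows "(1 / 2 * (v i (n + 1) \<bullet> (M i *\<^sub>v v i (n + 1)))
            + 1 / 2 * (d i (n + 1) \<bullet> (K i *\<^sub>v d i (n + 1))))
       - (1 / 2 * (v i n \<bullet> (M i *\<^sub>v v i n)) + 1 / 2 * (d i n \<bullet> (K i *\<^sub>v d i n)))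
       = \<Delta>t / 4 * (v i n \<bullet> (transpose_mat (C i) *\<^sub>v (lam n + lam (n + 1)))
            + v i (n + 1) \<bullet> (transpose_mat (C i) *\<^sub>v (lam n + lam (n + 1))))"
proof -
  note vc = v_carrier[OF i] and dc = d_carrier[OF i] and ac = a_carrier[OF i]
  have MK: "M i \<in> carrier_mat (N i) (N i)" "transpose_mat (M i) = M i"
      "K i \<in> carrier_mat (N i) (N i)" "transpose_mat (K i) = K i"
    using mass[OF i] stiffness[OF i] by (auto simp: sym_pos_def_mat_def sym_pos_semidef_mat_def)
  have dt: "subdomain_time_step \<Delta>t \<eta> i = \<Delta>t"
    using eta by (simp add: subdomain_time_step_def)
  have "v i (n + 1) = v i n + \<Delta>t \<cdot>\<^sub>v ((1 / 2) \<cdot>\<^sub>v a i n + (1 / 2) \<cdot>\<^sub>v a i (n + 1))"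
    using newmark_velocity[OF i, of 0 n] eta gam dt by simp
  also have "\<dots> = v i n + (\<Delta>t / 2) \<cdot>\<^sub>v (a i n + a i (n + 1))"
    using vc[of n] ac[of n] ac[of "n + 1"] by (intro eq_vecI) (auto simp: field_simps)
  finally have v1: "v i (n + 1) = v i n + (\<Delta>t / 2) \<cdot>\<^sub>v (a i n + a i (n + 1))" .
  have "d i (n + 1) = d i n + \<Delta>t \<cdot>\<^sub>v v i n
      + (\<Delta>t\<^sup>2 / 2) \<cdot>\<^sub>v ((1 / 2) \<cdot>\<^sub>v a i n + (1 / 2) \<cdot>\<^sub>v a i (n + 1))"
    using newmark_displacement[OF i, of 0 n] eta bet dt by simp
  also have "\<dots> = d i n + (\<Delta>t / 2) \<cdot>\<^sub>v (v i n + v i (n + 1))"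
    unfolding v1 by (rule newmark_average_displacement[OF dc vc ac ac])
  finally have d1: "d i (n + 1) = d i n + (\<Delta>t / 2) \<cdot>\<^sub>v (v i n + v i (n + 1))" .
  have Ct: "transpose_mat (C i) \<in> carrier_mat (N i) NC"
    using C_carrier[OF i] by simp
  have force: "transpose_mat (C i) *\<^sub>v lam n + transpose_mat (C i) *\<^sub>v lam (n + 1)
      = transpose_mat (C i) *\<^sub>v (lam n + lam (n + 1))"
    by (rule mult_add_distrib_mat_vec[OF Ct lam_carrier lam_carrier, symmetric])
  have "transpose_mat (C i) *\<^sub>v (lam n + lam (n + 1)) \<in> carrier_vec (N i)"
    using lam_carrier by (intro interface_force_carrier[OF i]) simp
  from add_scalar_prod_distrib[OF vc vc this]
    trapezoidal_energy_balance[OF MK vc dc ac ac v1 d1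
      equilibrium_at_level[OF i eta f0] equilibrium_at_level[OF i eta f0]]
  show ?thesis
    by (simp only: force)
qed

end

theorem theorem2:
  fixes S NC :: nat
    and N \<eta> :: "nat \<Rightarrow> nat"
    and M K C :: "nat \<Rightarrow> real mat"
    and f :: "nat \<Rightarrow> real \<Rightarrow> real vec"
    and \<beta> \<gamma> :: "nat \<Rightarrow> real"
    and \<Delta>t :: real
    and d v a :: "nat \<Rightarrow> nat \<Rightarrow> real vec"
    and lam :: "nat \<Rightarrow> real vec"
  assumes "coupling_method S NC N M K C f \<beta> \<gamma> \<Delta>t \<eta> d v a lam"
    and "\<And>i. i \<in> {1..S} \<Longrightarrow> \<gamma> i = 1 / 2"
    and "\<And>i. i \<in> {1..S} \<Longrightarrow> \<beta> i = 1 / 4"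
    and "\<And>i. i \<in> {1..S} \<Longrightarrow> \<eta> i = 1"
    and "\<And>i t. i \<in> {1..S} \<Longrightarrow> t \<ge> 0 \<Longrightarrow> f i t = 0\<^sub>v (N i)"
  shows "\<forall>n. total_energy S M K \<eta> d v (n + 1) = total_energy S M K \<eta> d v n"
proof
  fix n
  interpret coupling_method S NC N M K C f \<beta> \<gamma> \<Delta>t \<eta> d v a lam
    by (rule assms(1))
  let ?\<mu> = "lam n + lam (n + 1)"
  let ?P = "\<lambda>m i. v i (m * \<eta> i) \<bullet> (transpose_mat (C i) *\<^sub>v ?\<mu>)"
  have mu: "?\<mu> \<in> carrier_vec NC"
    using lam_carrier by simp
  have "total_energy S M K \<eta> d v (n + 1) - total_energy S M K \<eta> d v n
      = (\<Sum>i = 1..S. \<Delta>t / 4 * (?P n i + ?P (n + 1) i))"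
    unfolding total_energy_def sum_subtractf[symmetric]
  proof (rule sum.cong[OF refl], goal_cases)
    case (1 i)
    show ?case
      using subdomain_energy_change[OF 1 assms(4,2,3,5)[OF 1], of n] assms(4)[OF 1] by simp
  qed
  also have "\<dots> = \<Delta>t / 4 * ((\<Sum>i = 1..S. ?P n i) + (\<Sum>i = 1..S. ?P (n + 1) i))"
    by (simp only: sum_distrib_left[symmetric] sum.distrib)
  also have "\<dots> = 0"
    by (simp only: interface_power_zero[OF mu]) simp
  finally show "total_energy S M K \<eta> d v (n + 1) = total_energy S M K \<eta> d v n"
    by simp
qed

end
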